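(* Let $G$ be a finite simple graph on $n$ vertices and $m$ edges, with maximum vertex degree $\Delta$ and minimum vertex degree $\delta>0$, and let $\overline{m}=|E(\overline{G})|$. Then $$\overline{SO}(G)\leq \sqrt{\left(\frac{\delta}{\Delta}+\frac{\Delta}{\delta}\right)\overline{m}\,\overline{M}_2(G)}.$$ Equality holds if $G$ is a regular graph.
   Context: All graphs are finite and simple, with nonempty vertex set. $d_G(u)$ denotes the degree of $u$ in $G$, and $\overline{G}$ is the complement of $G$; $\overline{m}=|E(\overline{G})|=\binom{n}{2}-m$. The Sombor coindex and the second Zagreb coindex of $G$ are $$\overline{SO}(G)=\sum_{uv\in E(\overline{G})}\sqrt{d_G(u)^2+d_G(v)^2},\qquad \overline{M}_2(G)=\sum_{uv\in E(\overline{G})}d_G(u)\,d_G(v),$$ the sums being over unordered pairs of distinct non-adjacent vertices of $G$, with degrees taken in $G$. *)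

theory Defs
  imports Complex_Main "Graph_Theory.Pair_Digraph"
begin

text \<open>
  A finite simple graph is a \<^locale>\<open>pair_graph\<close>: a finite loop-free symmetric digraph
  whose arcs are ordered pairs of vertices. An undirected edge \<open>uv\<close> is thus represented by
  the two arcs \<open>(u, v)\<close> and \<open>(v, u)\<close>; \<open>edges\<close> identifies them, so that cardinalities of
  and sums over \<open>edges G\<close> count every edge exactly once.
\<close>

definition edges :: "'a pair_pre_digraph \<Rightarrow> 'a set set" where
  "edges G = {{u, v} | u v. (u, v) \<in> parcs G}"

text \<open>By symmetry, the out-degree is the number of neighbours.\<close>

definition vdegree :: "'a pair_pre_digraph \<Rightarrow> 'a \<Rightarrow> nat" where
  "vdegree G v = out_degree (with_proj G) v"

definition max_degree :: "'a pair_pre_digraph \<Rightarrow> nat" where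
  "max_degree G = Max (vdegree G ` pverts G)"

definition min_degree :: "'a pair_pre_digraph \<Rightarrow> nat" where
  "min_degree G = Min (vdegree G ` pverts G)"

definition regular_graph :: "'a pair_pre_digraph \<Rightarrow> bool" where
  "regular_graph G \<longleftrightarrow> (\<exists>k. \<forall>v \<in> pverts G. vdegree G v = k)"

definition graph_complement :: "'a pair_pre_digraph \<Rightarrow> 'a pair_pre_digraph" where
  "graph_complement G =
    \<lparr> pverts = pverts G,
      parcs = {(u, v). u \<in> pverts G \<and> v \<in> pverts G \<and> u \<noteq> v \<and> (u, v) \<notin> parcs G} \<rparr>"

text \<open>
  The sums range over the unordered edges of the complement, while degrees are taken in \<open>G\<close>.
  For \<open>e = {u, v}\<close> with \<open>u \<noteq> v\<close>, the inner sum over \<open>e\<close> is \<open>d(u)\<^sup>2 + d(v)\<^sup>2\<close> and the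
  inner product over \<open>e\<close> is \<open>d(u) d(v)\<close>; see \<open>edge_terms\<close> below.
\<close>

definition sombor_coindex :: "'a pair_pre_digraph \<Rightarrow> real" where
  "sombor_coindex G =
    (\<Sum>e \<in> edges (graph_complement G). sqrt (\<Sum>w \<in> e. (real (vdegree G w))\<^sup>2))"

definition second_zagreb_coindex :: "'a pair_pre_digraph \<Rightarrow> real" where
  "second_zagreb_coindex G =
    (\<Sum>e \<in> edges (graph_complement G). \<Prod>w \<in> e. real (vdegree G w))"

lemma edge_terms:
  assumes "u \<noteq> v"
  shows "(\<Sum>w \<in> {u, v}. (real (vdegree G w))\<^sup>2) = (real (vdegree G u))\<^sup>2 + (real (vdegree G v))\<^sup>2"
    and "(\<Prod>w \<in> {u, v}. real (vdegree G w)) = real (vdegree G u) * real (vdegree G v)"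
  using assms by simp_all

lemma edges_graph_complement:
  "edges (graph_complement G) =
    {{u, v} | u v. u \<in> pverts G \<and> v \<in> pverts G \<and> u \<noteq> v \<and> (u, v) \<notin> parcs G}"
  by (simp add: edges_def graph_complement_def)

lemma pair_graph_complement:
  assumes "pair_graph G"
  shows "pair_graph (graph_complement G)"
proof -
  interpret pair_graph G by fact
  have s: "(u, v) \<in> parcs G \<longleftrightarrow> (v, u) \<in> parcs G" for u v
    using pair_sym_arcs by (auto simp: symmetric_def sym_def arcs_ends_def arc_to_ends_def)
  have "finite (parcs (graph_complement G))"
    by (rule finite_subset[of _ "pverts G \<times> pverts G"]) (auto simp: graph_complement_def)
  then show ?thesis
    by unfold_locales
      (auto simp: graph_complement_def symmetric_def sym_def arcs_ends_def arc_to_ends_def s)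
qed

lemma card_edges_complement:
  assumes "pair_graph G"
  shows "card (edges (graph_complement G)) = (card (pverts G) choose 2) - card (edges G)"
proof -
  interpret pair_graph G by fact
  have s: "(u, v) \<in> parcs G \<longleftrightarrow> (v, u) \<in> parcs G" for u v
    using pair_sym_arcs by (auto simp: symmetric_def sym_def arcs_ends_def arc_to_ends_def)
  let ?P = "{e. e \<subseteq> pverts G \<and> card e = 2}"
  have sub: "edges G \<subseteq> ?P"
  proof
    fix e assume "e \<in> edges G"
    then obtain u v where e: "e = {u, v}" "(u, v) \<in> parcs G"
      by (auto simp: edges_def)
    then have "u \<in> pverts G" "v \<in> pverts G" "u \<noteq> v"
      using arc_fst_in_verts[of "(u, v)"] arc_snd_in_verts[of "(u, v)"] pair_no_loops[of "(u, v)"]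
      by auto
    with e show "e \<in> ?P" by simp
  qed
  have "edges (graph_complement G) = ?P - edges G"
    unfolding edges_def
    by (fastforce simp: graph_complement_def card_2_iff doubleton_eq_iff s)
  moreover have "card ?P = card (pverts G) choose 2"
    by (rule n_subsets) simp
  moreover have "finite (edges G)"
    by (rule finite_subset[OF sub]) simp
  ultimately show ?thesis
    using sub by (simp add: card_Diff_subset)
qed

end

theory Submission
  imports Defs "HOL-Analysis.Convex"
begin

text \<open>
  Write \<open>s e = d(u)\<^sup>2 + d(v)\<^sup>2\<close> and \<open>p e = d(u) d(v)\<close> for a non-edge \<open>e = {u, v}\<close>. The
  Cauchy--Schwarz inequality against the constant function 1 turns the sum of the \<open>sqrt (s e)\<close>
  into \<open>sqrt (mbar * (\<Sum>e. s e))\<close>, and it remains to compare \<open>s e\<close> with \<open>p e\<close> edge by edge. The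
  ratio \<open>s e / p e = t + 1/t\<close> depends only on \<open>t = d(u) / d(v)\<close>, which lies between
  \<open>\<delta> / \<Delta>\<close> and \<open>\<Delta> / \<delta>\<close>. On this interval \<open>t + 1/t\<close> is largest at the two ends, where it equals
  \<open>\<delta> / \<Delta> + \<Delta> / \<delta>\<close> (lemma \<open>sum_squares_le_ratio_times_product\<close>).

  In a regular graph, \<open>\<delta> = \<Delta>\<close> and every non-edge has the same \<open>s e\<close>, so both estimates are
  equalities.
\<close>

text \<open>
  After clearing denominators, the difference of the two sides factors as
  \<open>(b y - a x) (b x - a y)\<close>, and both factors are nonnegative on the square \<open>[a, b]\<^sup>2\<close>.
\<close>

lemma sum_squares_le_ratio_times_product:
  fixes a b x y :: real
  assumes "0 < a" "a \<le> x" "x \<le> b" "a \<le> y" "y \<le> b"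
  shows "x\<^sup>2 + y\<^sup>2 \<le> (a / b + b / a) * (x * y)"
proof -
  have "0 < b" using assms by linarith
  have "a * x \<le> b * y" "a * y \<le> b * x"
    using assms mult_mono[of a y x b] mult_mono[of a x y b] by (simp_all add: mult.commute)
  then have "0 \<le> (b * y - a * x) * (b * x - a * y)"
    by simp
  also have "\<dots> = a * b * ((a / b + b / a) * (x * y) - (x\<^sup>2 + y\<^sup>2))"
    using \<open>0 < a\<close> \<open>0 < b\<close> by (simp add: field_simps power2_eq_square)
  finally show ?thesis
    using \<open>0 < a\<close> \<open>0 < b\<close> by (auto simp: zero_le_mult_iff mult_le_0_iff)
qed

lemma sum_sqrt_le_sqrt_card_times_sum:
  fixes f :: "'b \<Rightarrow> real"
  assumes "\<And>i. i \<in> I \<Longrightarrow> 0 \<le> f i"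
  shows "(\<Sum>i\<in>I. sqrt (f i)) \<le> sqrt (real (card I) * sum f I)"
proof (rule real_le_rsqrt)
  have "(\<Sum>i\<in>I. sqrt (f i))\<^sup>2 \<le> (\<Sum>i\<in>I. (sqrt (f i))\<^sup>2) * real (card I)"
    by (rule sum_squared_le_sum_of_squares)
  then show "(\<Sum>i\<in>I. sqrt (f i))\<^sup>2 \<le> real (card I) * sum f I"
    using assms by (simp add: mult.commute)
qed

lemma vdegree_bounds:
  assumes "pair_graph G" "v \<in> pverts G"
  shows "min_degree G \<le> vdegree G v" and "vdegree G v \<le> max_degree G"
proof -
  interpret pair_graph G by fact
  show "min_degree G \<le> vdegree G v" "vdegree G v \<le> max_degree G"
    using assms(2) by (simp_all add: min_degree_def max_degree_def)
qed

theorem theorem4p5: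
  fixes G :: "'a pair_pre_digraph"
    and n m mbar \<Delta> \<delta> :: nat
  assumes "pair_graph G"
    and "pverts G \<noteq> {}"
    and "n = card (pverts G)"
    and "m = card (edges G)"
    and "mbar = card (edges (graph_complement G))"
    and "\<Delta> = max_degree G"
    and "\<delta> = min_degree G"
    and "\<delta> > 0"
  shows "sombor_coindex G
           \<le> sqrt ((real \<delta> / real \<Delta> + real \<Delta> / real \<delta>) * real mbar * second_zagreb_coindex G)
       \<and> (regular_graph G \<longrightarrow>
           sombor_coindex G
             = sqrt ((real \<delta> / real \<Delta> + real \<Delta> / real \<delta>) * real mbar * second_zagreb_coindex G))"
proof (intro conjI impI)
  let ?E = "edges (graph_complement G)"
  let ?r = "real \<delta> / real \<Delta> + real \<Delta> / real \<delta>"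
  define s where "s e = (\<Sum>w\<in>e. (real (vdegree G w))\<^sup>2)" for e
  define p where "p e = (\<Prod>w\<in>e. real (vdegree G w))" for e
  have so: "sombor_coindex G = (\<Sum>e\<in>?E. sqrt (s e))"
    and zg: "second_zagreb_coindex G = sum p ?E"
    by (simp_all add: sombor_coindex_def second_zagreb_coindex_def s_def p_def)
  have nonedge: "\<exists>u v. u \<in> pverts G \<and> v \<in> pverts G \<and> s e = (real (vdegree G u))\<^sup>2 + (real (vdegree G v))\<^sup>2
      \<and> p e = real (vdegree G u) * real (vdegree G v)" if "e \<in> ?E" for e
    using that edge_terms[of _ _ G] unfolding edges_graph_complement s_def p_def by blast
  have s_le: "s e \<le> ?r * p e" if e: "e \<in> ?E" for e
  proof -
    obtain u v where "u \<in> pverts G" "v \<in> pverts G"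
      and "s e = (real (vdegree G u))\<^sup>2 + (real (vdegree G v))\<^sup>2"
      and "p e = real (vdegree G u) * real (vdegree G v)"
      using nonedge[OF e] by blast
    then show ?thesis
      using sum_squares_le_ratio_times_product[of "real \<delta>" "real (vdegree G u)" "real \<Delta>" "real (vdegree G v)"]
        vdegree_bounds[OF assms(1)] assms(6-8) by simp
  qed
  have "sombor_coindex G \<le> sqrt (real mbar * sum s ?E)"
    using sum_sqrt_le_sqrt_card_times_sum[of ?E s] by (simp add: so assms(5) s_def sum_nonneg)
  also have "\<dots> \<le> sqrt (?r * real mbar * second_zagreb_coindex G)"
  proof -
    have "sum s ?E \<le> ?r * second_zagreb_coindex G"
      unfolding zg sum_distrib_left by (rule sum_mono) (rule s_le)
    from mult_left_mono[OF this, of "real mbar"] show ?thesis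
      by (simp add: mult_ac)
  qed
  finally show "sombor_coindex G \<le> sqrt (?r * real mbar * second_zagreb_coindex G)" .

  assume "regular_graph G"
  then obtain k where k: "vdegree G v = k" if "v \<in> pverts G" for v
    by (auto simp: regular_graph_def)
  have "vdegree G ` pverts G = {k}"
    using k assms(2) by force
  then have deg: "\<delta> = k" "\<Delta> = k"
    by (simp_all add: assms(6,7) min_degree_def max_degree_def)
  have sp: "s e = 2 * (real k)\<^sup>2" "p e = (real k)\<^sup>2" if "e \<in> ?E" for e
    using nonedge[OF that] k by (auto simp: power2_eq_square)
  have "sombor_coindex G = real mbar * sqrt (2 * (real k)\<^sup>2)"
    by (simp add: so assms(5) sp)
  also have "\<dots> = sqrt (?r * real mbar * second_zagreb_coindex G)"
    using assms(8) by (simp add: zg sp deg assms(5) real_sqrt_mult)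
  finally show "sombor_coindex G = sqrt (?r * real mbar * second_zagreb_coindex G)" .
qed

end
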